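(* Let $n\geq 3$ and let $K_1, K_2\subset\mathbb{C}^n$ be either two closed convex sets or two finite sets. Suppose that for every complex plane $\Lambda\subset\mathbb{C}^n$ through the origin there is a complex number $z_\Lambda\in\mathbb{C}$ such that $$z_\Lambda(\pi_\Lambda(K_1))=\pi_\Lambda(K_2).$$ Then there is $z\in\mathbb{C}$ such that $$zK_1=K_2.$$
   Context: A complex plane through the origin is a complex linear subspace of $\mathbb{C}^n$ of complex dimension $2$. For a complex linear subspace $\Lambda\subset\mathbb{C}^n$, $\pi_\Lambda:\mathbb{C}^n\to\Lambda$ denotes the orthogonal projection (with respect to the standard Hermitian inner product). For $z\in\mathbb{C}$ and $A\subset\mathbb{C}^n$, $zA=\{za \mid a\in A\}$. *)

theory Defs
  imports "HOL-Analysis.Analysis"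
begin

definition hermitian_inner :: "complex ^ 'n \<Rightarrow> complex ^ 'n \<Rightarrow> complex"
  where "hermitian_inner x y = (\<Sum>i\<in>UNIV. x $ i * cnj (y $ i))"

definition complex_plane :: "(complex ^ 'n) set \<Rightarrow> bool"
  where "complex_plane \<Lambda> \<longleftrightarrow> vec.subspace \<Lambda> \<and> vec.dim \<Lambda> = 2"

(* Meaningful only if \<Lambda> is a complex linear subspace, see orth_proj_ex1. *)
definition orth_proj :: "(complex ^ 'n) set \<Rightarrow> complex ^ 'n \<Rightarrow> complex ^ 'n"
  where "orth_proj \<Lambda> x = (THE p. p \<in> \<Lambda> \<and> (\<forall>y\<in>\<Lambda>. hermitian_inner (x - p) y = 0))"

lemma inner_eq_Re_hermitian_inner: "x \<bullet> y = Re (hermitian_inner x y)"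
  by (simp add: inner_vec_def hermitian_inner_def inner_complex_def)

lemma orth_proj_ex1:
  assumes "vec.subspace \<Lambda>"
  shows "\<exists>!p. p \<in> \<Lambda> \<and> (\<forall>y\<in>\<Lambda>. hermitian_inner (x - p) y = 0)"
proof -
  have scale: "c *s y \<in> \<Lambda>" if "y \<in> \<Lambda>" for c y
    using assms that by (rule vec.subspace_scale)
  have real_scale: "r *\<^sub>R y = complex_of_real r *s y" for r and y :: "complex ^ 'n"
    by (simp add: vec_eq_iff complex_eq_iff)
  have sub: "subspace \<Lambda>"
    using assms unfolding subspace_def vec.subspace_def real_scale by blast
  have span: "span \<Lambda> = \<Lambda>"
    using sub by (simp add: span_eq_iff)
  obtain p q where p: "p \<in> \<Lambda>" and q: "\<And>w. w \<in> \<Lambda> \<Longrightarrow> orthogonal q w" and x: "x = p + q"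
    using orthogonal_subspace_decomp_exists[of \<Lambda> x] unfolding span by metis
  have "hermitian_inner (x - p) y = 0" if y: "y \<in> \<Lambda>" for y
  proof -
    have "Re (hermitian_inner q y) = 0"
      using q[OF y] by (simp add: orthogonal_def inner_eq_Re_hermitian_inner)
    moreover have "hermitian_inner q (\<i> *s y) = - \<i> * hermitian_inner q y"
      by (simp add: hermitian_inner_def sum_distrib_left sum_negf algebra_simps)
    then have "Im (hermitian_inner q y) = 0"
      using q[OF scale[OF y, of \<i>]] by (simp add: orthogonal_def inner_eq_Re_hermitian_inner)
    ultimately show ?thesis
      by (simp add: x complex_eq_iff)
  qed
  moreover have "p' = p''"
    if "p' \<in> \<Lambda>" "\<forall>y\<in>\<Lambda>. hermitian_inner (x - p') y = 0"
      "p'' \<in> \<Lambda>" "\<forall>y\<in>\<Lambda>. hermitian_inner (x - p'') y = 0" for p' p''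
  proof -
    have d: "p' - p'' \<in> \<Lambda>"
      using sub that by (simp add: subspace_diff)
    have "(p' - p'') \<bullet> (p' - p'') = (x - p'') \<bullet> (p' - p'') - (x - p') \<bullet> (p' - p'')"
      by (simp add: inner_diff_left)
    also have "\<dots> = 0"
      using that d by (simp add: inner_eq_Re_hermitian_inner)
    finally show ?thesis by simp
  qed
  ultimately show ?thesis
    using p by blast
qed

end

theory Submission
  imports Defs "HOL-Number_Theory.Cong"
begin

text \<open>
  For a direction \<open>v\<close> let \<open>A v\<close> and \<open>B v\<close> be the closures of the images of \<open>K\<^sub>1\<close> and \<open>K\<^sub>2\<close>
  under \<open>x \<mapsto> \<langle>x, v\<rangle>\<close>. Any two directions lie in a common complex plane, so the sets
  \<open>W v = {z. z A v = B v}\<close> meet pairwise. Apart from degenerate directions, \<open>W v\<close> is a coset of the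
  stabilizer of \<open>A v\<close> in the multiplicative group of \<open>\<complex>\<close>. This stabilizer is a product of a group
  of moduli, which is trivial or everything, and a closed group of rotations, hence
  \<open>W v\<close> is cut out by an optional prescription of \<open>|z|\<close> and an equation \<open>(z / |z|) ^ k = c\<close>
  (\<open>k = 0\<close> for the full circle). As in the Chinese remainder theorem, pairwise
  solvable equations of this form have a common solution \<open>z\<close>. Then \<open>z K\<^sub>1\<close> and \<open>K\<^sub>2\<close> have the
  same images in every direction up to closure, and therefore coincide.
\<close>

section \<open>Systems of power equations on the unit circle\<close>

lemma power_eq_1_coprime:
  fixes y :: "'a::monoid_mult"
  assumes "y ^ a = 1" "y ^ b = 1" "coprime a b"
  shows "y = 1"
proof (cases "a = 0")
  case True
  then show ?thesis using assms by simp
next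
  case False
  then obtain m n where "a * m = b * n + 1"
    using bezout_nat[of a b] assms(3) by (auto simp: coprime_iff_gcd_eq_1)
  then have "y ^ (a * m) = y ^ (b * n) * y"
    by (simp add: power_commutes)
  then show ?thesis
    using assms by (simp add: power_mult)
qed

lemma power_eq_1_dvd:
  fixes y :: "'a::monoid_mult"
  assumes "y ^ a = 1" "a dvd b"
  shows "y ^ b = 1"
  using assms by (auto simp: power_mult elim!: dvdE)

text \<open>An equation \<open>u ^ k = p ^ k\<close> on the circle acts like a residue class modulo
  \<open>k\<close>; this is the Chinese remainder step for the moduli \<open>gcd k l\<close> and
  \<open>m\<close>. Solvability requires \<open>q / p\<close> to be killed by the exponent
  \<open>lcm (gcd k l) m\<close>, which follows from \<open>k\<close> directly and from
  \<open>l\<close> by way of \<open>s\<close>.\<close>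

lemma merge_congruences:
  fixes p q s :: complex
  assumes norm: "norm p = 1" "norm q = 1" "norm s = 1"
    and pq: "p ^ k = q ^ k" and ps: "p ^ l = s ^ l" and qs: "q ^ m = s ^ m" and "k > 0"
  shows "\<exists>x. norm x = 1 \<and> x ^ gcd k l = p ^ gcd k l \<and> x ^ m = q ^ m"
proof (cases "m = 0")
  case True
  then show ?thesis using norm by auto
next
  case False
  define g where "g = gcd k l"
  define d where "d = gcd g m"
  have nz: "p \<noteq> 0" "q \<noteq> 0" "s \<noteq> 0" using norm by auto
  have "g > 0" "d > 0" using \<open>k > 0\<close> by (auto simp: g_def d_def)
  define M where "M = lcm g m"
  have "g dvd M" "m dvd M" by (auto simp: M_def)
  obtain k' l' where kl: "k = g * k'" "l = g * l'" "coprime k' l'"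
    using gcd_coprime_exists[of k l] \<open>k > 0\<close> unfolding g_def by (metis gcd_nat.eq_neutr_iff less_numeral_extra(3) mult.commute)
  have 1: "(p / q) ^ k = 1" "(p / s) ^ l = 1" "(s / q) ^ m = 1"
    using pq ps qs nz by (simp_all add: power_divide)
  \<comment> \<open>\<open>M * k'\<close> is a multiple of \<open>g * k' = k\<close>, and likewise
    \<open>M * l'\<close> of \<open>l\<close>; since \<open>k'\<close> and \<open>l'\<close> are
    coprime, both extra factors drop out.\<close>
  have "((q / p) ^ M) ^ k' = 1"
  proof -
    have "k dvd M * k'" using \<open>g dvd M\<close> kl by (auto intro: mult_dvd_mono)
    with 1(1) have "(p / q) ^ (M * k') = 1" by (rule power_eq_1_dvd)
    then show ?thesis using nz by (simp add: power_mult power_divide)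
  qed
  moreover have "((q / p) ^ M) ^ l' = 1"
  proof -
    have "l dvd M * l'" using \<open>g dvd M\<close> kl by (auto intro: mult_dvd_mono)
    with 1(2) have "(p / s) ^ (M * l') = 1" by (rule power_eq_1_dvd)
    moreover have "(s / q) ^ M = 1" using 1(3) \<open>m dvd M\<close> by (rule power_eq_1_dvd)
    ultimately show ?thesis using nz by (simp add: power_mult power_divide)
  qed
  ultimately have y: "(q / p) ^ M = 1"
    using power_eq_1_coprime kl(3) by blast
  obtain g' m' where gm: "g = d * g'" "m = d * m'" "coprime g' m'"
    using gcd_coprime_exists[of g m] \<open>d > 0\<close> unfolding d_def by (metis less_numeral_extra(3) mult.commute)
  have M: "M = g * m'" "M = m * g'"
  proof -
    have "d * M = g * m" by (simp add: M_def d_def)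
    then show "M = g * m'" "M = m * g'" using gm \<open>d > 0\<close> by (auto simp: mult_ac)
  qed
  \<comment> \<open>The exponent \<open>a\<close> makes \<open>(q / p) ^ a\<close> trivial at the
    exponent \<open>g\<close> but leaves it equal to \<open>q / p\<close> at the exponent
    \<open>m\<close>, so \<open>p * e\<close> meets both demands.\<close>
  obtain a where a: "[a = 0] (mod m')" "[a = 1] (mod g')"
    using binary_chinese_remainder_nat[of m' g' 0 1] gm(3) by (auto simp: coprime_commute)
  define e where "e = (q / p) ^ a"
  have "e ^ g = 1"
  proof -
    have "M dvd a * g" using a(1) M by (auto simp: cong_0_iff mult_ac)
    with y have "(q / p) ^ (a * g) = 1" by (rule power_eq_1_dvd)
    then show ?thesis by (simp add: e_def power_mult)
  qed
  moreover have "e ^ m = (q / p) ^ m"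
  proof -
    have "[m * a = m * 1] (mod M)"
      unfolding M(2) using a(2) by (simp add: cong_def mod_mult_mult1)
    then have "(m * a) mod M = m mod M" by (simp add: cong_def)
    moreover have "(q / p) ^ n = (q / p) ^ (n mod M)" for n
    proof -
      have "(q / p) ^ n = (q / p) ^ (M * (n div M) + n mod M)" by simp
      also have "\<dots> = (q / p) ^ (n mod M)" unfolding power_add power_mult using y by simp
      finally show ?thesis .
    qed
    ultimately show ?thesis
      unfolding e_def power_mult[symmetric] by (metis mult.commute)
  qed
  moreover have "norm e = 1"
    using norm by (simp add: e_def norm_power norm_divide)
  ultimately have "norm (p * e) = 1 \<and> (p * e) ^ gcd k l = p ^ gcd k l \<and> (p * e) ^ m = q ^ m"
    using norm nz by (simp add: g_def[symmetric] norm_mult power_mult_distrib power_divide)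
  then show ?thesis by blast
qed

text \<open>
  A least positive exponent \<open>m\<close> for which some equation \<open>u ^ m = p ^ m\<close> is compatible with each given
  equation must divide every \<open>k i\<close>: otherwise merging produces the smaller exponent \<open>gcd m (k i)\<close>.
\<close>
lemma power_equations_common_solution:
  fixes k :: "'i \<Rightarrow> nat" and c :: "'i \<Rightarrow> complex"
  assumes pair: "\<And>i j. i \<in> I \<Longrightarrow> j \<in> I \<Longrightarrow> \<exists>u. norm u = 1 \<and> u ^ k i = c i \<and> u ^ k j = c j"
  shows "\<exists>u. norm u = 1 \<and> (\<forall>i\<in>I. u ^ k i = c i)"
proof (cases "\<exists>i\<in>I. k i > 0")
  case False
  have "(1::complex) ^ k i = c i" if "i \<in> I" for i
    using pair[OF that that] False that by auto
  then show ?thesis by (intro exI[of _ 1]) auto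
next
  case True
  define P where "P = (\<lambda>m. m > 0 \<and> (\<exists>p. norm p = 1 \<and>
    (\<forall>i\<in>I. \<exists>u. norm u = 1 \<and> u ^ m = p ^ m \<and> u ^ k i = c i)))"
  have "\<exists>m. P m"
  proof -
    obtain i where i: "i \<in> I" "k i > 0" using True by blast
    obtain p where p: "norm p = 1" "p ^ k i = c i" using pair[OF i(1) i(1)] by blast
    have "P (k i)" unfolding P_def using i p pair[OF i(1)] by auto
    then show ?thesis ..
  qed
  then obtain m where "P m" and min: "\<And>m'. m' < m \<Longrightarrow> \<not> P m'"
    using exists_least_iff[of P] by blast
  then obtain p where "m > 0" and p: "norm p = 1"
    and comp: "\<And>i. i \<in> I \<Longrightarrow> \<exists>u. norm u = 1 \<and> u ^ m = p ^ m \<and> u ^ k i = c i"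
    unfolding P_def by blast
  have "p ^ k i = c i" if i: "i \<in> I" for i
  proof -
    obtain u where u: "norm u = 1" "u ^ m = p ^ m" "u ^ k i = c i" using comp[OF i] by blast
    \<comment> \<open>Merging takes \<open>u\<close> in the role of \<open>p\<close>, a solution
      \<open>q\<close> for the exponents \<open>m\<close> and \<open>k j\<close>, and a solution
      \<open>s\<close> for \<open>k i\<close> and \<open>k j\<close>. Hence \<open>u\<close>
      witnesses \<open>P (gcd m (k i))\<close>.\<close>
    have "\<exists>x. norm x = 1 \<and> x ^ gcd m (k i) = u ^ gcd m (k i) \<and> x ^ k j = c j" if j: "j \<in> I" for j
    proof -
      obtain q where q: "norm q = 1" "q ^ m = p ^ m" "q ^ k j = c j" using comp[OF j] by blast
      obtain s where s: "norm s = 1" "s ^ k i = c i" "s ^ k j = c j" using pair[OF i j] by blast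
      show ?thesis
        using merge_congruences[OF u(1) q(1) s(1), of m "k i" "k j"] u q s \<open>m > 0\<close> by simp
    qed
    then have "P (gcd m (k i))" unfolding P_def using u(1) \<open>m > 0\<close> by auto
    with min have "\<not> gcd m (k i) < m" by blast
    then have "m dvd k i" using \<open>m > 0\<close>
      by (metis gcd_dvd1 gcd_dvd2 dvd_imp_le le_neq_implies_less)
    then show ?thesis using u by (metis dvd_def power_mult)
  qed
  then show ?thesis using p by blast
qed

section \<open>Closed subgroups of the circle\<close>

lemma dist_cis_le: "norm (cis a - cis b) \<le> \<bar>a - b\<bar>"
proof -
  have "cis a - cis b = cis b * (exp (\<i> * of_real (a - b)) - 1)"
    unfolding cis_conv_exp[symmetric] by (simp add: cis_mult right_diff_distrib)
  then have "norm (cis a - cis b) = 2 * \<bar>sin ((a - b) / 2)\<bar>"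
    by (simp only: norm_mult norm_cis dist_exp_i_1)
  also have "\<dots> \<le> 2 * \<bar>(a - b) / 2\<bar>"
    by (intro mult_left_mono abs_sin_x_le_abs_x) auto
  finally show ?thesis by simp
qed

text \<open>A finite subgroup of order \<open>k\<close> is the full group of \<open>k\<close>-th
  roots of unity, by counting. An infinite one accumulates, so it contains rotations by arbitrarily
  small nonzero angles, is dense, and being closed is the whole circle.\<close>

lemma closed_circle_subgroup:
  fixes S :: "complex set"
  assumes "closed S" and circ: "\<And>u. u \<in> S \<Longrightarrow> norm u = 1" and "1 \<in> S"
    and mult: "\<And>u v. u \<in> S \<Longrightarrow> v \<in> S \<Longrightarrow> u * v \<in> S"
    and inv: "\<And>u. u \<in> S \<Longrightarrow> inverse u \<in> S"
  shows "\<exists>k. S = {u. norm u = 1 \<and> u ^ k = 1}"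
proof (cases "finite S")
  case True
  define k where "k = card S"
  have "k > 0" using True \<open>1 \<in> S\<close> by (auto simp: k_def card_gt_0_iff)
  have "u ^ k = 1" if u: "u \<in> S" for u
  proof -
    have "u \<noteq> 0" using circ[OF u] by auto
    \<comment> \<open>Multiplication by \<open>u\<close> permutes \<open>S\<close>; comparing the
      product of all elements before and after gives \<open>u ^ k = 1\<close>.\<close>
    have "bij_betw ((*) u) S S"
      by (rule bij_betw_byWitness[where f' = "(*) (inverse u)"])
        (use \<open>u \<noteq> 0\<close> in \<open>auto intro: mult[OF u] mult[OF inv[OF u]]\<close>)
    then have "(\<Prod>x\<in>S. x) = (\<Prod>x\<in>S. u * x)"
      by (rule prod.reindex_bij_betw[symmetric])
    also have "\<dots> = u ^ k * (\<Prod>x\<in>S. x)" by (simp add: prod.distrib k_def)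
    finally have "u ^ k * (\<Prod>x\<in>S. x) = 1 * (\<Prod>x\<in>S. x)" by simp
    moreover have "(\<Prod>x\<in>S. x) \<noteq> 0" using True circ[of 0] by auto
    ultimately show ?thesis by (simp only: mult_cancel_right) simp
  qed
  then have "S \<subseteq> {u. u ^ k = 1}" by blast
  moreover have "card {u::complex. u ^ k = 1} = card S"
    using card_roots_unity_eq[OF \<open>k > 0\<close>] k_def by simp
  ultimately have "S = {u. u ^ k = 1}"
    using finite_roots_unity[of k] \<open>k > 0\<close> by (intro card_subset_eq) auto
  then show ?thesis using circ by blast
next
  case False
  have pow: "u ^ n \<in> S" if "u \<in> S" for u and n :: nat
    by (induction n) (auto intro: mult[OF that] \<open>1 \<in> S\<close>)
  have "w \<in> S" if w: "norm w = 1" for w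
  proof -
    have "\<exists>x\<in>S. dist x w < e" if "e > 0" for e
    proof -
      obtain d where "d > 0" and d: "\<And>u. dist u 1 < d \<Longrightarrow> dist (Arg u) (Arg 1) < e"
        using continuous_at_Arg[of 1] \<open>e > 0\<close> unfolding continuous_at_eps_delta by (auto simp: dist_norm)
      have "compact S"
        using \<open>closed S\<close> circ by (auto simp: compact_eq_bounded_closed bounded_iff)
      then obtain x where "x \<in> S" and lim: "x islimpt S"
        using False compact_eq_Bolzano_Weierstrass by (metis subset_refl)
      then obtain y where y: "y \<in> S" "y \<noteq> x" "dist y x < d"
        using \<open>d > 0\<close> by (meson islimpt_approachable)
      \<comment> \<open>The quotient of two distinct nearby elements is a nontrivial rotation by a
        small angle.\<close>
      define u where "u = y * inverse x"
      have "u \<in> S" unfolding u_def using y \<open>x \<in> S\<close> by (intro mult inv)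
      have "x \<noteq> 0" "norm x = 1" using circ[OF \<open>x \<in> S\<close>] by auto
      have "u \<noteq> 1" using y \<open>x \<noteq> 0\<close> by (auto simp: u_def field_simps)
      have "norm (u - 1) = norm ((y - x) * inverse x)"
        using \<open>x \<noteq> 0\<close> by (simp add: u_def algebra_simps)
      then have "dist u 1 < d" using y(3) \<open>norm x = 1\<close> by (simp add: dist_norm norm_mult norm_inverse)
      define \<delta> where "\<delta> = Arg u"
      have u: "u = cis \<delta>"
        using circ[OF \<open>u \<in> S\<close>] cis_Arg[of u] by (cases "u = 0") (auto simp: \<delta>_def sgn_eq)
      have "\<bar>\<delta>\<bar> < e" using d[OF \<open>dist u 1 < d\<close>] by (simp add: \<delta>_def dist_real_def)
      have "\<delta> \<noteq> 0" using u \<open>u \<noteq> 1\<close> by auto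
      \<comment> \<open>Steps of size \<open>\<delta>\<close> from 0 come within
        \<open>\<bar>\<delta>\<bar>\<close> of \<open>Arg w\<close>. As \<open>n\<close> may be
        negative, an integer power of \<open>u\<close> is taken.\<close>
      define n where "n = \<lfloor>Arg w / \<delta>\<rfloor>"
      have w': "w = cis (Arg w)"
        using w cis_Arg[of w] by (cases "w = 0") (auto simp: sgn_eq)
      have "u powi n \<in> S" using \<open>u \<in> S\<close> by (auto simp: power_int_def intro: pow inv)
      moreover have "dist (u powi n) w < e"
      proof -
        have "\<bar>Arg w / \<delta> - of_int n\<bar> \<le> 1" unfolding n_def by linarith
        then have "\<bar>\<delta> * (Arg w / \<delta> - of_int n)\<bar> \<le> \<bar>\<delta>\<bar>"
          unfolding abs_mult by (intro mult_left_le) auto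
        moreover have "\<delta> * (Arg w / \<delta> - of_int n) = Arg w - of_int n * \<delta>"
          using \<open>\<delta> \<noteq> 0\<close> by (simp add: right_diff_distrib)
        ultimately have b: "\<bar>of_int n * \<delta> - Arg w\<bar> \<le> \<bar>\<delta>\<bar>" by linarith
        have "dist (u powi n) w = norm (cis (of_int n * \<delta>) - cis (Arg w))"
          unfolding u cis_power_int dist_norm using w' by simp
        also have "\<dots> \<le> \<bar>of_int n * \<delta> - Arg w\<bar>"
          by (rule dist_cis_le)
        finally show ?thesis using b \<open>\<bar>\<delta>\<bar> < e\<close> by linarith
      qed
      ultimately show ?thesis by blast
    qed
    then have "w \<in> closure S" by (simp add: closure_approachable)
    then show ?thesis using \<open>closed S\<close> by simp
  qed
  \<comment> \<open>The exponent 0 encodes the full circle.\<close>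
  then have "S = {u. norm u = 1 \<and> u ^ 0 = 1}" using circ by auto
  then show ?thesis by blast
qed

section \<open>Complex multipliers between planar sets\<close>

lemma mult_image_inverse:
  fixes w :: "'a::field"
  assumes "w \<noteq> 0" "(*) w ` A = B"
  shows "(*) (inverse w) ` B = A"
  unfolding assms(2)[symmetric] image_image using assms(1) by (simp add: mult.assoc[symmetric])

text \<open>By compactness of the closed unit disc some subsequence of the powers is Cauchy, and the
  quotient of two close powers is near 1.\<close>

lemma rotation_recurrence:
  fixes u :: complex
  assumes "norm u = 1" "e > 0"
  shows "\<exists>n\<ge>N. norm (u ^ n - 1) < e"
proof -
  have "u ^ n \<in> cball 0 1" for n
    using assms by (simp add: norm_power)
  then obtain l r where r: "strict_mono (r :: nat \<Rightarrow> nat)" and lim: "((\<lambda>n. u ^ n) \<circ> r) \<longlonglongrightarrow> l"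
    using compact_imp_seq_compact[OF compact_cball[of "0::complex" 1]] seq_compactE
    by (metis (no_types, lifting))
  obtain M where M: "\<And>m n. m \<ge> M \<Longrightarrow> n \<ge> M \<Longrightarrow> dist (u ^ r m) (u ^ r n) < e"
    using LIMSEQ_imp_Cauchy[OF lim] \<open>e > 0\<close> unfolding Cauchy_def by (metis comp_apply)
  \<comment> \<open>Since \<open>n \<le> r n\<close>, this choice puts the exponents
    \<open>r n\<close> and \<open>r M\<close> at least \<open>N\<close> apart, while
    \<open>n \<ge> M\<close> keeps the Cauchy bound.\<close>
  define n where "n = r M + N + M"
  have "n \<le> r n" using r by (rule seq_suble)
  define k where "k = r n - r M"
  have k: "r n = r M + k" "k \<ge> N" using \<open>n \<le> r n\<close> by (auto simp: k_def n_def)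
  have "norm (u ^ r n - u ^ r M) = norm (u ^ r M * (u ^ k - 1))"
    unfolding k power_add by (simp add: right_diff_distrib)
  also have "\<dots> = norm (u ^ k - 1)" using assms by (simp add: norm_mult norm_power)
  finally have "norm (u ^ k - 1) < e" using M[of n M] by (simp add: n_def dist_norm)
  then show ?thesis using k by blast
qed

text \<open>
  The points \<open>t (u / |u|) ^ n a\<close> lie on the segments from \<open>0\<close> to \<open>u ^ n a\<close>, and \<open>(u / |u|) ^ n\<close>
  returns arbitrarily close to \<open>1\<close>.
\<close>
lemma self_similar_cone:
  fixes A :: "complex set"
  assumes "closed A" "convex A" and A: "(*) u ` A = A" and u: "norm u > 1"
    and "t > 0" "a \<in> A"
  shows "of_real t * a \<in> A"
proof -
  have "u \<noteq> 0" using u by auto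
  have pow: "u ^ n * a \<in> A" for n
  proof (induction n)
    case (Suc n)
    then have "u * (u ^ n * a) \<in> A" using A by blast
    then show ?case by (simp add: mult.assoc)
  qed (use \<open>a \<in> A\<close> in simp)
  have A': "(*) (inverse u) ` A = A" using \<open>u \<noteq> 0\<close> A by (rule mult_image_inverse)
  have ipow: "inverse u ^ n * a \<in> A" for n
  proof (induction n)
    case (Suc n)
    then have "inverse u * (inverse u ^ n * a) \<in> A" using A' by blast
    then show ?case by (simp add: mult.assoc)
  qed (use \<open>a \<in> A\<close> in simp)
  have "(\<lambda>n. inverse u ^ n * a) \<longlonglongrightarrow> 0 * a"
    using u by (intro tendsto_intros LIMSEQ_power_zero) (simp add: norm_inverse inverse_less_1_iff)
  then have "0 \<in> A"
    using closed_sequentially[OF \<open>closed A\<close>] ipow by fastforce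
  have "\<exists>y\<in>A. dist y (of_real t * a) < e" if "e > 0" for e
  proof -
    \<comment> \<open>The summand 1 keeps the denominator positive when
      \<open>a = 0\<close>.\<close>
    define e' where "e' = e / (t * norm a + 1)"
    have pos: "t * norm a + 1 > 0" using \<open>t > 0\<close> by (simp add: add_nonneg_pos)
    then have "e' > 0" using that by (simp add: e'_def)
    obtain N where N: "t < norm u ^ N" using real_arch_pow[OF u] by blast
    obtain n where n: "n \<ge> N" "norm (sgn u ^ n - 1) < e'"
      using rotation_recurrence[of "sgn u" e' N] \<open>e' > 0\<close> \<open>u \<noteq> 0\<close> by (auto simp: norm_sgn)
    have "norm u ^ N \<le> norm u ^ n" using n u by (intro power_increasing) auto
    then have "t \<le> norm u ^ n" using N by linarith
    then have tn: "t / norm u ^ n \<le> 1" "t / norm u ^ n \<ge> 0" using \<open>t > 0\<close> \<open>u \<noteq> 0\<close> by simp_all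
    have "(1 - t / norm u ^ n) *\<^sub>R 0 + (t / norm u ^ n) *\<^sub>R (u ^ n * a) \<in> A"
      by (rule convexD[OF \<open>convex A\<close> \<open>0 \<in> A\<close> pow]) (use tn in auto)
    moreover have "(t / norm u ^ n) *\<^sub>R (u ^ n * a) = of_real t * sgn u ^ n * a"
      by (simp add: sgn_eq power_divide scaleR_conv_of_real)
    ultimately have "of_real t * sgn u ^ n * a \<in> A" by simp
    moreover have "dist (of_real t * sgn u ^ n * a) (of_real t * a) < e"
    proof -
      have "dist (of_real t * sgn u ^ n * a) (of_real t * a) = norm (of_real t * a * (sgn u ^ n - 1))"
        unfolding dist_norm by (simp add: algebra_simps)
      also have "\<dots> = t * norm a * norm (sgn u ^ n - 1)" using \<open>t > 0\<close> by (simp add: norm_mult)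
      also have "\<dots> \<le> t * norm a * e'" using n \<open>t > 0\<close> by (intro mult_left_mono) auto
      also have "\<dots> < (t * norm a + 1) * e'" using \<open>e' > 0\<close> by simp
      also have "\<dots> = e" using pos by (simp add: e'_def)
      finally show ?thesis .
    qed
    ultimately show ?thesis by blast
  qed
  then have "of_real t * a \<in> closure A" by (simp add: closure_approachable)
  then show ?thesis using \<open>closed A\<close> by simp
qed

text \<open>The orbit \<open>u ^ n * a\<close> of a nonzero point is unbounded.\<close>

lemma bounded_self_similar:
  fixes A :: "complex set"
  assumes "bounded A" and A: "(*) u ` A = A" and u: "norm u > 1"
  shows "A \<subseteq> {0}"
proof
  fix a assume "a \<in> A"
  have pow: "u ^ n * a \<in> A" for n
  proof (induction n)
    case (Suc n)
    then have "u * (u ^ n * a) \<in> A" using A by blast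
    then show ?case by (simp add: mult.assoc)
  qed (use \<open>a \<in> A\<close> in simp)
  obtain R where R: "\<And>x. x \<in> A \<Longrightarrow> norm x \<le> R" using \<open>bounded A\<close> by (auto simp: bounded_iff)
  show "a \<in> {0}"
  proof (rule ccontr)
    assume "a \<notin> {0}"
    then have "norm a > 0" by simp
    obtain n where "R / norm a < norm u ^ n" using real_arch_pow[OF u] by blast
    then have "R < norm (u ^ n * a)" using \<open>norm a > 0\<close> by (simp add: norm_mult norm_power field_simps)
    then show False using R[OF pow[of n]] by simp
  qed
qed

text \<open>This is the dichotomy for moduli: one stabilizing multiplier off the unit circle forces
  every positive scaling. After inversion its modulus exceeds 1; boundedness is then impossible, and
  convexity makes the set a cone.\<close>

lemma self_similar_scaling:
  fixes A :: "complex set"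
  assumes "closed A" "convex A \<or> bounded A" "\<not> A \<subseteq> {0}" and A: "(*) u ` A = A"
    and "u \<noteq> 0" "norm u \<noteq> 1" "t > 0"
  shows "(*) (of_real t) ` A = A"
proof -
  obtain v where v: "(*) v ` A = A" "norm v > 1"
  proof (cases "norm u > 1")
    case False
    then have "norm (inverse u) > 1"
      using \<open>u \<noteq> 0\<close> \<open>norm u \<noteq> 1\<close> by (simp add: norm_inverse one_less_inverse)
    then show ?thesis using that mult_image_inverse[OF \<open>u \<noteq> 0\<close> A] by blast
  qed (use A that in blast)
  with assms(2,3) bounded_self_similar have "convex A" by blast
  have cone: "of_real s * a \<in> A" if "s > 0" "a \<in> A" for s a
    using self_similar_cone[OF \<open>closed A\<close> \<open>convex A\<close> v that] .
  have "a \<in> (*) (of_real t) ` A" if "a \<in> A" for a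
    using cone[of "inverse t" a] \<open>t > 0\<close> that by (intro image_eqI[of _ _ "of_real (inverse t) * a"]) auto
  then show ?thesis using cone[OF \<open>t > 0\<close>] by blast
qed

text \<open>The unit multipliers in question form the coset through \<open>u\<^sub>0\<close> of the
  rotation stabilizer of \<open>A\<close>. That stabilizer is a closed circle subgroup, hence given
  by \<open>u ^ k = 1\<close>, and \<open>c = u\<^sub>0 ^ k\<close>.\<close>

lemma similarity_rotations:
  fixes A B :: "complex set"
  assumes "closed A" "r > 0" "norm u\<^sub>0 = 1" "(*) (of_real r * u\<^sub>0) ` A = B"
  shows "\<exists>k c. {u. norm u = 1 \<and> (*) (of_real r * u) ` A = B} = {u. norm u = 1 \<and> u ^ k = c}"
proof -
  define S where "S = {u. norm u = 1 \<and> (*) u ` A = A}"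
  have comp: "(*) (u * v) ` A = (*) u ` (*) v ` A" for u v and A :: "complex set"
    by (simp add: image_image mult.assoc)
  have inv: "inverse u \<in> S" if "u \<in> S" for u
    using that mult_image_inverse[of u A A] by (cases "u = 0") (simp_all add: S_def norm_inverse)
  \<comment> \<open>On the circle the inverse is \<open>cnj\<close>, which is continuous everywhere,
    so invariance under \<open>u\<close> and its inverse becomes an intersection of closed
    conditions.\<close>
  have "S = {u. norm u = 1} \<inter> (\<Inter>a\<in>A. {u. u * a \<in> A} \<inter> {u. cnj u * a \<in> A})"
  proof (intro equalityI subsetI)
    fix u assume u: "u \<in> S"
    then have "u * cnj u = 1" by (simp add: S_def complex_norm_square[symmetric])
    then have "inverse u = cnj u" by (rule inverse_unique)
    then show "u \<in> {u. norm u = 1} \<inter> (\<Inter>a\<in>A. {u. u * a \<in> A} \<inter> {u. cnj u * a \<in> A})"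
      using u inv[OF u] by (auto simp: S_def)
  next
    fix u assume u: "u \<in> {u. norm u = 1} \<inter> (\<Inter>a\<in>A. {u. u * a \<in> A} \<inter> {u. cnj u * a \<in> A})"
    have "u * cnj u = 1" using u by (simp add: complex_norm_square[symmetric])
    then have "a = u * (cnj u * a)" for a by (simp add: mult.assoc[symmetric])
    then have "a \<in> (*) u ` A" if "a \<in> A" for a using u that by blast
    then show "u \<in> S" using u by (auto simp: S_def)
  qed
  moreover have "closed {u. f u * a \<in> A}" if "continuous_on UNIV f" for f :: "complex \<Rightarrow> complex" and a
    using continuous_closed_vimage[OF \<open>closed A\<close>, of "\<lambda>u. f u * a"] that
    by (simp add: vimage_def continuous_on_eq_continuous_at)
  then have "closed {u. u * a \<in> A}" "closed {u. cnj u * a \<in> A}" for a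
    by (auto intro: continuous_intros)
  moreover have "closed {u::complex. norm u = 1}"
    by (intro closed_Collect_eq continuous_intros)
  ultimately have "closed S" by (auto intro!: closed_Int closed_INT)
  moreover have "u * v \<in> S" if "u \<in> S" "v \<in> S" for u v
    using that by (simp add: S_def norm_mult comp)
  moreover have "norm u = 1" if "u \<in> S" for u
    using that by (simp add: S_def)
  moreover have "1 \<in> S"
    by (simp add: S_def)
  ultimately obtain k where k: "S = {u. norm u = 1 \<and> u ^ k = 1}"
    using closed_circle_subgroup[of S] inv by blast
  have "u\<^sub>0 \<noteq> 0" using assms by auto
  have "(*) (of_real r * u) ` A = B \<longleftrightarrow> u ^ k = u\<^sub>0 ^ k" if u: "norm u = 1" for u
  proof -
    have "of_real r * u = (of_real r * u\<^sub>0) * (u / u\<^sub>0)"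
      using \<open>u\<^sub>0 \<noteq> 0\<close> by simp
    then have "(*) (of_real r * u) ` A = (*) (of_real r * u\<^sub>0) ` (*) (u / u\<^sub>0) ` A"
      by (simp only: comp)
    moreover have "inj ((*) (of_real r * u\<^sub>0))"
      using \<open>u\<^sub>0 \<noteq> 0\<close> \<open>r > 0\<close> by (simp add: inj_on_def)
    ultimately have "(*) (of_real r * u) ` A = B \<longleftrightarrow> (*) (u / u\<^sub>0) ` A = A"
      using assms(4) by (metis inj_image_eq_iff)
    also have "\<dots> \<longleftrightarrow> u / u\<^sub>0 \<in> S" using u assms(3) by (simp add: S_def norm_divide)
    also have "\<dots> \<longleftrightarrow> u ^ k = u\<^sub>0 ^ k"
      using u assms(3) \<open>u\<^sub>0 \<noteq> 0\<close> by (simp add: k norm_divide power_divide)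
    finally show ?thesis .
  qed
  then show ?thesis by blast
qed

text \<open>Nonzero multipliers split into modulus and rotation. First one modulus \<open>r\<close>
  is found that suits every pair of indices; the remaining rotations are governed by pairwise
  solvable power equations.\<close>

lemma common_similarity:
  fixes A B :: "'i \<Rightarrow> complex set"
  assumes A: "\<And>i. i \<in> I \<Longrightarrow> closed (A i) \<and> (convex (A i) \<or> bounded (A i))"
    and pair: "\<And>i j. i \<in> I \<Longrightarrow> j \<in> I \<Longrightarrow> \<exists>z. (*) z ` A i = B i \<and> (*) z ` A j = B j"
  shows "\<exists>z. \<forall>i\<in>I. (*) z ` A i = B i"
proof (cases "\<exists>i\<in>I. \<not> A i \<subseteq> {0} \<and> B i \<subseteq> {0}")
  case True
  \<comment> \<open>A nonzero point sent to 0 forces the multiplier 0 for \<open>i\<close>, and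
    hence for every index paired with \<open>i\<close>.\<close>
  then obtain i a where i: "i \<in> I" "a \<in> A i" "a \<noteq> 0" "B i \<subseteq> {0}" by blast
  have "(*) 0 ` A j = B j" if j: "j \<in> I" for j
  proof -
    obtain z where z: "(*) z ` A i = B i" "(*) z ` A j = B j" using pair[OF i(1) j] by blast
    then have "z * a = 0" using i by blast
    then show ?thesis using z i by simp
  qed
  then show ?thesis by blast
next
  case False
  \<comment> \<open>Outside \<open>J\<close> the set \<open>A i\<close> is empty or
    \<open>{0}\<close>, and every multiplier works there.\<close>
  define J where "J = {i\<in>I. \<not> A i \<subseteq> {0}}"
  have triv: "(*) z ` A i = B i" if "i \<in> I - J" for i z
  proof -
    have "A i = {} \<or> A i = {0}" using that by (auto simp: J_def)
    then show ?thesis using pair[of i i] that by auto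
  qed
  have pairJ: "\<exists>w. w \<noteq> 0 \<and> (*) w ` A i = B i \<and> (*) w ` A j = B j" if ij: "i \<in> J" "j \<in> J" for i j
  proof -
    obtain w where w: "(*) w ` A i = B i" "(*) w ` A j = B j"
      using pair[of i j] ij by (auto simp: J_def)
    moreover have "w \<noteq> 0"
    proof
      assume "w = 0"
      with w(1) have "B i \<subseteq> {0}" by auto
      then show False using False ij by (auto simp: J_def)
    qed
    ultimately show ?thesis by blast
  qed
  \<comment> \<open>For \<open>scal i\<close> the modulus of a multiplier is free; otherwise it is
    determined, as \<open>rigid\<close> shows.\<close>
  define scal where "scal i \<longleftrightarrow> (\<forall>t::real>0. (*) (of_real t) ` A i = A i)" for i
  have rigid: "norm w = norm w'"
    if "i \<in> J" "\<not> scal i" "w \<noteq> 0" "w' \<noteq> 0" "(*) w ` A i = B i" "(*) w' ` A i = B i" for i w w'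
  proof (rule ccontr)
    assume "norm w \<noteq> norm w'"
    have "(*) (inverse w * w') ` A i = (*) (inverse w) ` (*) w' ` A i"
      by (simp add: image_image mult.assoc)
    also have "\<dots> = A i" using mult_image_inverse that by metis
    finally have "(*) (inverse w * w') ` A i = A i" .
    moreover have "inverse w * w' \<noteq> 0" using that by simp
    moreover have "norm (inverse w * w') \<noteq> 1"
      unfolding norm_mult norm_inverse using that \<open>norm w \<noteq> norm w'\<close> by (simp add: field_simps)
    ultimately have "scal i"
      unfolding scal_def using self_similar_scaling A[of i] that(1) by (simp add: J_def)
    then show False using that by simp
  qed
  have rescale: "(*) (of_real t * w) ` A i = B i" if "scal i" "t > 0" "(*) w ` A i = B i" for i w and t :: real
  proof -
    have "(*) (of_real t * w) ` A i = (*) w ` (*) (of_real t) ` A i"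
      by (simp add: image_image mult_ac)
    then show ?thesis using that by (simp add: scal_def)
  qed
  \<comment> \<open>If all moduli are free, take \<open>r = 1\<close>; otherwise some index
    \<open>l\<close> with determined modulus dictates \<open>r\<close>.\<close>
  obtain r where "r > 0" and r: "\<And>i j. i \<in> J \<Longrightarrow> j \<in> J \<Longrightarrow>
      \<exists>w. norm w = r \<and> (*) w ` A i = B i \<and> (*) w ` A j = B j"
  proof (cases "\<forall>i\<in>J. scal i")
    case True
    have "\<exists>w. norm w = 1 \<and> (*) w ` A i = B i \<and> (*) w ` A j = B j" if ij: "i \<in> J" "j \<in> J" for i j
    proof -
      obtain w where "w \<noteq> 0" "(*) w ` A i = B i" "(*) w ` A j = B j" using pairJ[OF ij] by blast
      then show ?thesis
        using rescale[of i "inverse (norm w)" w] rescale[of j "inverse (norm w)" w] True ij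
        by (intro exI[of _ "of_real (inverse (norm w)) * w"]) (auto simp: norm_mult norm_inverse)
    qed
    then show ?thesis using that[of 1] by simp
  next
    case False
    then obtain l where l: "l \<in> J" "\<not> scal l" by blast
    obtain w\<^sub>0 where w0: "w\<^sub>0 \<noteq> 0" "(*) w\<^sub>0 ` A l = B l" using pairJ[OF l(1) l(1)] by blast
    \<comment> \<open>A multiplier shared by \<open>i\<close> and \<open>l\<close> carries the
      determined modulus of both, so these agree.\<close>
    have fixed: "norm w = norm w\<^sub>0" if i: "i \<in> J" "\<not> scal i" and w: "w \<noteq> 0" "(*) w ` A i = B i" for i w
    proof -
      obtain v where "v \<noteq> 0" "(*) v ` A i = B i" "(*) v ` A l = B l" using pairJ[OF i(1) l(1)] by blast
      then show ?thesis using rigid[OF i w(1) _ w(2)] rigid[OF l w0(1) _ w0(2)] by metis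
    qed
    have "\<exists>w. norm w = norm w\<^sub>0 \<and> (*) w ` A i = B i \<and> (*) w ` A j = B j" if ij: "i \<in> J" "j \<in> J" for i j
    proof -
      obtain w where w: "w \<noteq> 0" "(*) w ` A i = B i" "(*) w ` A j = B j" using pairJ[OF ij] by blast
      show ?thesis
      proof (cases "scal i \<and> scal j")
        case True
        then show ?thesis
          using rescale[of i "norm w\<^sub>0 / norm w" w] rescale[of j "norm w\<^sub>0 / norm w" w] w w0(1)
          by (intro exI[of _ "of_real (norm w\<^sub>0 / norm w) * w"]) (auto simp: norm_mult norm_divide)
      next
        case False
        \<comment> \<open>One of the two indices has determined modulus, so the shared multiplier
          already has the right one.\<close>
        then show ?thesis using fixed ij w by metis
      qed
    qed
    then show ?thesis using that[of "norm w\<^sub>0"] w0(1) by simp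
  qed
  have rot: "\<exists>u. norm u = 1 \<and> (*) (of_real r * u) ` A i = B i \<and> (*) (of_real r * u) ` A j = B j"
    if ij: "i \<in> J" "j \<in> J" for i j
  proof -
    obtain w where "norm w = r" "(*) w ` A i = B i" "(*) w ` A j = B j" using r[OF ij] by blast
    then show ?thesis using \<open>r > 0\<close> by (intro exI[of _ "w / of_real r"]) (auto simp: norm_divide)
  qed
  have ex: "\<forall>i\<in>J. \<exists>k c. {u. norm u = 1 \<and> (*) (of_real r * u) ` A i = B i} = {u. norm u = 1 \<and> u ^ k = c}"
  proof
    fix i assume "i \<in> J"
    with rot[of i i] A[of i] \<open>r > 0\<close>
    show "\<exists>k c. {u. norm u = 1 \<and> (*) (of_real r * u) ` A i = B i} = {u. norm u = 1 \<and> u ^ k = c}"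
      using similarity_rotations[of "A i" r _ "B i"] by (auto simp: J_def)
  qed
  from bchoice[OF ex] obtain k where
    "\<forall>i\<in>J. \<exists>c. {u. norm u = 1 \<and> (*) (of_real r * u) ` A i = B i} = {u. norm u = 1 \<and> u ^ k i = c}" ..
  from bchoice[OF this] obtain c where kc: "\<And>i. i \<in> J \<Longrightarrow>
      {u. norm u = 1 \<and> (*) (of_real r * u) ` A i = B i} = {u. norm u = 1 \<and> u ^ k i = c i}"
    by blast
  have "\<exists>u. norm u = 1 \<and> u ^ k i = c i \<and> u ^ k j = c j" if "i \<in> J" "j \<in> J" for i j
    using rot[OF that] kc[OF that(1)] kc[OF that(2)] by blast
  then obtain u where "norm u = 1" "\<forall>i\<in>J. u ^ k i = c i"
    using power_equations_common_solution[of J k c] by blast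
  then have "(*) (of_real r * u) ` A i = B i" if "i \<in> J" for i
    using kc[OF that] that by blast
  then show ?thesis using triv by blast
qed

section \<open>Hermitian products and complex planes\<close>

lemma hermitian_inner_scale_left: "hermitian_inner (z *s x) v = z * hermitian_inner x v"
  by (simp add: hermitian_inner_def sum_distrib_left mult.assoc)

lemma hermitian_inner_diff_left: "hermitian_inner (x - y) v = hermitian_inner x v - hermitian_inner y v"
  by (simp add: hermitian_inner_def sum_subtractf left_diff_distrib)

lemma hermitian_inner_add_right: "hermitian_inner x (v + w) = hermitian_inner x v + hermitian_inner x w"
  by (simp add: hermitian_inner_def sum.distrib distrib_left)

lemma hermitian_inner_scale_right: "hermitian_inner x (z *s v) = cnj z * hermitian_inner x v"
  by (simp add: hermitian_inner_def sum_distrib_left mult_ac)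

lemma linear_hermitian_inner: "linear (\<lambda>x. hermitian_inner x v)"
  by (rule linearI)
    (simp_all add: hermitian_inner_def sum.distrib distrib_right scaleR_sum_right)

lemma linear_vector_scalar_mult: "linear ((*s) z :: complex ^ 'n \<Rightarrow> complex ^ 'n)"
  by (rule linearI) (simp_all add: vec_eq_iff distrib_left scaleR_conv_of_real)

text \<open>The residual \<open>x - orth_proj \<Lambda> x\<close> is orthogonal to
  \<open>\<Lambda>\<close>. Pairing with vectors of \<open>\<Lambda>\<close> thus turns statements
  about projections to planes into statements about planar sets.\<close>

lemma hermitian_inner_orth_proj:
  assumes "complex_plane \<Lambda>" "v \<in> \<Lambda>"
  shows "hermitian_inner (orth_proj \<Lambda> x) v = hermitian_inner x v"
proof -
  have "orth_proj \<Lambda> x \<in> \<Lambda> \<and> (\<forall>y\<in>\<Lambda>. hermitian_inner (x - orth_proj \<Lambda> x) y = 0)"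
    unfolding orth_proj_def
    by (rule theI'[OF orth_proj_ex1]) (use assms(1) in \<open>simp add: complex_plane_def\<close>)
  then show ?thesis
    using assms(2) by (simp add: hermitian_inner_diff_left)
qed

text \<open>As \<open>v\<close> and \<open>w\<close> may be dependent, a maximal independent subset
  of \<open>{v, w}\<close> is enlarged inside a basis to exactly two vectors.\<close>

lemma complex_plane_containing:
  fixes v w :: "complex ^ 'n"
  assumes "CARD('n) \<ge> 2"
  obtains \<Lambda> where "complex_plane \<Lambda>" "v \<in> \<Lambda>" "w \<in> \<Lambda>"
proof -
  obtain C where C: "C \<subseteq> {v, w}" "vec.independent C" "{v, w} \<subseteq> vec.span C"
    using vec.maximal_independent_subset[of "{v, w}"] by metis
  define D where "D = vec.extend_basis C"
  have D: "C \<subseteq> D" "vec.independent D" "vec.span D = UNIV"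
    unfolding D_def using C(2) vec.extend_basis_superset vec.independent_extend_basis by auto
  have "card D = CARD('n)"
    using vec.dim_eq_card_independent[OF D(2)] D(3) vec.dim_span[of D] vec.dim_UNIV
    by (simp add: card_cart_basis)
  moreover have "finite D" using D(2) vec.finiteI_independent by blast
  moreover have "card C \<le> 2"
    using card_mono[OF _ C(1)] card_insert_le_m1[of 2 "{w}" v] by auto
  ultimately obtain E where E: "C \<subseteq> E" "E \<subseteq> D" "card E = 2"
    using exists_subset_between[of C 2 D] D(1) assms by auto
  have "vec.independent E" using E D vec.independent_mono by blast
  then have "complex_plane (vec.span E)"
    using E(3) by (simp add: complex_plane_def vec.dim_span vec.dim_eq_card_independent)
  moreover have "{v, w} \<subseteq> vec.span E" using C(3) vec.span_mono[OF E(1)] by blast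
  ultimately show ?thesis using that by blast
qed

section \<open>Recovering a set from its images in all directions\<close>

text \<open>A direction \<open>v\<close> good for \<open>F\<close> is perturbed to
  \<open>v + z *s d\<close>. Each vector excludes at most one \<open>z\<close>: those in
  \<open>F\<close> have nonzero constant term, and \<open>d\<close> has nonzero coefficient of
  \<open>cnj z\<close>.\<close>

lemma exists_separating_direction:
  fixes F :: "(complex ^ 'n) set"
  assumes "finite F" "0 \<notin> F"
  shows "\<exists>v. \<forall>d\<in>F. hermitian_inner d v \<noteq> 0"
  using assms
proof (induction F)
  case empty
  then show ?case by simp
next
  case (insert d F)
  then obtain v where v: "\<And>e. e \<in> F \<Longrightarrow> hermitian_inner e v \<noteq> 0" by auto
  define bad where "bad e = {z. hermitian_inner e (v + z *s d) = 0}" for e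
  have "finite (bad e)" if "hermitian_inner e v \<noteq> 0 \<or> hermitian_inner e d \<noteq> 0" for e
  proof -
    have "bad e \<subseteq> {cnj (- hermitian_inner e v / hermitian_inner e d)}"
    proof
      fix z assume "z \<in> bad e"
      then have "hermitian_inner e v + cnj z * hermitian_inner e d = 0"
        by (simp add: bad_def hermitian_inner_add_right hermitian_inner_scale_right)
      moreover from this that have "hermitian_inner e d \<noteq> 0" by auto
      ultimately have "cnj z = - hermitian_inner e v / hermitian_inner e d"
        by (simp add: field_simps add_eq_0_iff)
      then show "z \<in> {cnj (- hermitian_inner e v / hermitian_inner e d)}"
        by (metis complex_cnj_cnj singletonI)
    qed
    then show ?thesis using finite_subset by blast
  qed
  moreover have "hermitian_inner d d \<noteq> 0"
    using insert.prems inner_eq_zero_iff[of d] by (auto simp: inner_eq_Re_hermitian_inner simp del: inner_eq_zero_iff)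
  ultimately have "finite (\<Union>e\<in>insert d F. bad e)" using insert.hyps v by auto
  then obtain z where "z \<notin> (\<Union>e\<in>insert d F. bad e)"
    using infinite_UNIV_char_0[where 'a = complex] by (metis ex_new_if_finite)
  then show ?case by (auto simp: bad_def)
qed

text \<open>For a point outside \<open>L\<close>, some direction is orthogonal to none of its
  finitely many differences with \<open>L\<close>, so its image misses that of
  \<open>L\<close>.\<close>

lemma finite_subset_by_projections:
  fixes K L :: "(complex ^ 'n) set"
  assumes "finite L" "\<And>v. (\<lambda>x. hermitian_inner x v) ` K \<subseteq> (\<lambda>x. hermitian_inner x v) ` L"
  shows "K \<subseteq> L"
proof
  fix x assume "x \<in> K"
  show "x \<in> L"
  proof (rule ccontr)
    assume "x \<notin> L"
    then obtain v where v: "\<And>d. d \<in> (-) x ` L \<Longrightarrow> hermitian_inner d v \<noteq> 0"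
      using exists_separating_direction[of "(-) x ` L"] \<open>finite L\<close> by fastforce
    obtain y where "y \<in> L" "hermitian_inner x v = hermitian_inner y v"
      using assms(2)[of v] \<open>x \<in> K\<close> by blast
    then show False using v[of "x - y"] by (simp add: hermitian_inner_diff_left)
  qed
qed

text \<open>A separating real hyperplane with normal \<open>v\<close> becomes a vertical line in the
  image under pairing with \<open>v\<close>. The half-plane beyond it is closed, so passing to the
  closure does no harm.\<close>

lemma closed_convex_subset_by_projections:
  fixes K L :: "(complex ^ 'n) set"
  assumes "closed L" "convex L"
    and "\<And>v. (\<lambda>x. hermitian_inner x v) ` K \<subseteq> closure ((\<lambda>x. hermitian_inner x v) ` L)"
  shows "K \<subseteq> L"
proof
  fix x assume "x \<in> K"
  show "x \<in> L"
  proof (rule ccontr)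
    assume "x \<notin> L"
    then obtain v b where v: "v \<bullet> x < b" "\<And>y. y \<in> L \<Longrightarrow> b < v \<bullet> y"
      using separating_hyperplane_closed_point[OF assms(2,1)] by metis
    have "(\<lambda>x. hermitian_inner x v) ` L \<subseteq> {c. b \<le> Re c}"
      using v(2) by (force simp: inner_eq_Re_hermitian_inner[symmetric] inner_commute)
    then have "closure ((\<lambda>x. hermitian_inner x v) ` L) \<subseteq> {c. b \<le> Re c}"
      by (rule closure_minimal) (simp add: closed_halfspace_Re_ge)
    then have "b \<le> Re (hermitian_inner x v)" using assms(3)[of v] \<open>x \<in> K\<close> by blast
    then show False using v(1) by (simp add: inner_eq_Re_hermitian_inner[symmetric] inner_commute)
  qed
qed

section \<open>From complex planes to single directions and back\<close>

theorem theorem3: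
  fixes K\<^sub>1 K\<^sub>2 :: "(complex ^ 'n) set"
  assumes "CARD('n) \<ge> 3"
    and "(closed K\<^sub>1 \<and> convex K\<^sub>1 \<and> closed K\<^sub>2 \<and> convex K\<^sub>2) \<or> (finite K\<^sub>1 \<and> finite K\<^sub>2)"
    and "\<And>\<Lambda>. complex_plane \<Lambda> \<Longrightarrow>
           \<exists>z :: complex. (*s) z ` (orth_proj \<Lambda> ` K\<^sub>1) = orth_proj \<Lambda> ` K\<^sub>2"
  shows "\<exists>z :: complex. (*s) z ` K\<^sub>1 = K\<^sub>2"
proof -
  define P where "P v K = (\<lambda>x. hermitian_inner x v) ` K" for v :: "complex ^ 'n" and K
  have scale: "P v ((*s) z ` K) = (*) z ` P v K" for v z K
    by (simp add: P_def image_image hermitian_inner_scale_left)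
  have proj: "P v (orth_proj \<Lambda> ` K) = P v K" if "complex_plane \<Lambda>" "v \<in> \<Lambda>" for v \<Lambda> K
    using that by (simp add: P_def image_image hermitian_inner_orth_proj)
  have clos: "closure ((*) z ` A) = (*) z ` closure A" for z :: complex and A
    by (cases "z = 0") (auto simp: image_constant_conv closure_injective_linear_image linear_times inj_on_def)
  \<comment> \<open>Closures are taken because the image of a closed convex set under a linear map
    need not be closed, whereas \<open>common_similarity\<close> works with closed sets.\<close>
  have "\<exists>z. \<forall>v\<in>UNIV. (*) z ` closure (P v K\<^sub>1) = closure (P v K\<^sub>2)"
  proof (rule common_similarity)
    fix v :: "complex ^ 'n"
    have "convex (P v K\<^sub>1)" if "convex K\<^sub>1"
      unfolding P_def using that by (intro convex_linear_image linear_hermitian_inner)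
    moreover have "bounded (P v K\<^sub>1)" if "finite K\<^sub>1"
      unfolding P_def using that by (intro finite_imp_bounded finite_imageI)
    ultimately show "closed (closure (P v K\<^sub>1)) \<and> (convex (closure (P v K\<^sub>1)) \<or> bounded (closure (P v K\<^sub>1)))"
      using assms(2) by (auto intro: convex_closure)
  next
    fix v w :: "complex ^ 'n"
    \<comment> \<open>The multiplier of one plane through both \<open>v\<close> and \<open>w\<close>
      serves both directions at once.\<close>
    obtain \<Lambda> where \<Lambda>: "complex_plane \<Lambda>" "v \<in> \<Lambda>" "w \<in> \<Lambda>"
      using complex_plane_containing[of v w] assms(1) by auto
    obtain z where "(*s) z ` orth_proj \<Lambda> ` K\<^sub>1 = orth_proj \<Lambda> ` K\<^sub>2"
      using assms(3)[OF \<Lambda>(1)] by blast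
    then have "(*) z ` P u K\<^sub>1 = P u K\<^sub>2" if "u \<in> \<Lambda>" for u
      using proj[OF \<Lambda>(1) that] scale by metis
    then have "(*) z ` closure (P u K\<^sub>1) = closure (P u K\<^sub>2)" if "u \<in> \<Lambda>" for u
      using clos that by metis
    then show "\<exists>z. (*) z ` closure (P v K\<^sub>1) = closure (P v K\<^sub>2) \<and> (*) z ` closure (P w K\<^sub>1) = closure (P w K\<^sub>2)"
      using \<Lambda> by blast
  qed
  then obtain z where z: "\<And>v. closure (P v ((*s) z ` K\<^sub>1)) = closure (P v K\<^sub>2)"
    unfolding scale clos by blast
  have "(*s) z ` K\<^sub>1 = K\<^sub>2"
  proof (cases "finite K\<^sub>1 \<and> finite K\<^sub>2")
    case True
    \<comment> \<open>Images of finite sets are finite, hence closed, and the closures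
      disappear.\<close>
    then have "P v ((*s) z ` K\<^sub>1) = P v K\<^sub>2" for v
      using z[of v] by (simp add: P_def closure_closed finite_imp_closed)
    then show ?thesis
      unfolding P_def using True by (intro equalityI finite_subset_by_projections) auto
  next
    case False
    then have K: "closed K\<^sub>1" "convex K\<^sub>1" "closed K\<^sub>2" "convex K\<^sub>2" using assms(2) by auto
    \<comment> \<open>Closedness survives scaling: for \<open>z = 0\<close> the image is empty or
      \<open>{0}\<close>, otherwise the map is injective and linear.\<close>
    have "closed ((*s) z ` K\<^sub>1)"
    proof (cases "z = 0")
      case False
      then have "inj ((*s) z :: complex ^ 'n \<Rightarrow> complex ^ 'n)"
        by (simp add: inj_on_def vec_eq_iff)
      then show ?thesis
        using K(1) linear_vector_scalar_mult by (rule closed_injective_linear_image[rotated -1])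
    qed (simp add: image_constant_conv)
    moreover have "convex ((*s) z ` K\<^sub>1)"
      using K(2) linear_vector_scalar_mult by (rule convex_linear_image[rotated])
    ultimately show ?thesis
      using K by (intro equalityI closed_convex_subset_by_projections)
        (use z closure_subset in \<open>simp_all add: P_def[symmetric], blast+\<close>)
  qed
  then show ?thesis ..
qed

end
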